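(* Let $p\in[1,\infty)$ and $t\in[0,1)$. Let $w=(w(n))_{n=0}^\infty$ be any strictly positive weight on $\mathbb{N}_0$ satisfying $w(n)\downarrow0$ (that is, $w$ is decreasing with limit $0$). The operator $\mathcal{C}_t\in\mathcal{L}(\ell^p(w))$ satisfies $\|\mathcal{C}_t\|_{\ell^p(w)\to\ell^p(w)}\le(1-t)^{-1}$, is compact and has spectrum $\sigma(\mathcal{C}_t;\ell^p(w))=\Lambda\cup\{0\}$. Moreover, the fine spectra of $\mathcal{C}_t$ are given by $$\sigma_{\mathrm p}(\mathcal{C}_t;\ell^p(w))=\Lambda,\quad \sigma_{\mathrm c}(\mathcal{C}_t;\ell^p(w))=\{0\},\quad \sigma_{\mathrm r}(\mathcal{C}_t;\ell^p(w))=\emptyset.$$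
   Context: Let $\mathbb{N}_0=\{0,1,2,\dots\}$ and $\Lambda:=\{1/(n+1):n\in\mathbb{N}_0\}$. For $t\in[0,1]$ the generalized Cesàro operator on $\mathbb{C}^{\mathbb{N}_0}$ is $(\mathcal{C}_tx)_n=\frac{1}{n+1}\sum_{k=0}^n t^{n-k}x_k$ (with $0^0=1$). $\mathcal{C}_t\in\mathcal{L}(X)$ means that it maps $X$ continuously into itself; the restriction is also denoted $\mathcal{C}_t$. $\ell^p(w):=\{x\in\mathbb{C}^{\mathbb{N}_0}:\|x\|_{p,w}:=(\sum_{n=0}^\infty|x_n|^pw(n))^{1/p}<\infty\}$ with norm $\|\cdot\|_{p,w}$. $\mathcal{L}(X)$ is the space of continuous linear operators on $X$. For $T\in\mathcal{L}(X)$: $\sigma(T;X)$ is the set of $\lambda\in\mathbb{C}$ with $T-\lambda I$ not invertible in $\mathcal{L}(X)$; $\sigma_{\mathrm p}(T;X)$ is the set of $\lambda$ with $T-\lambda I$ not injective; $\sigma_{\mathrm c}(T;X)$ is the set of $\lambda$ with $T-\lambda I$ injective and range a proper dense subspace of $X$; $\sigma_{\mathrm r}(T;X)$ is the set of $\lambda$ with $T-\lambda I$ injective and range not dense in $X$. *)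

theory Defs
  imports "HOL-Analysis.Analysis"
begin

type_synonym cseq = "nat \<Rightarrow> complex"

definition cesaro :: "real \<Rightarrow> cseq \<Rightarrow> cseq" where
  "cesaro t x = (\<lambda>n. (1 / of_nat (n + 1)) * (\<Sum>k=0..n. of_real t ^ (n - k) * x k))"

definition Lam :: "complex set" where
  "Lam = {1 / of_nat (n + 1) | n :: nat. True}"

definition lpw :: "real \<Rightarrow> (nat \<Rightarrow> real) \<Rightarrow> cseq set" where
  "lpw p w = {x. summable (\<lambda>n. cmod (x n) powr p * w n)}"

definition lpw_norm :: "real \<Rightarrow> (nat \<Rightarrow> real) \<Rightarrow> cseq \<Rightarrow> real" where
  "lpw_norm p w x = (\<Sum>n. cmod (x n) powr p * w n) powr (1 / p)"

text \<open>Since \<open>p\<close> and \<open>w\<close> are terms, the weighted space cannot be a type of its own. A space of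
  sequences is therefore given as a topology \<open>X\<close> on \<^typ>\<open>cseq\<close> whose carrier is \<^term>\<open>topspace X\<close>;
  operators are total functions of which only the restriction to the carrier matters.\<close>

definition lpw_top :: "real \<Rightarrow> (nat \<Rightarrow> real) \<Rightarrow> cseq topology" where
  "lpw_top p w = Metric_space.mtopology (lpw p w) (\<lambda>x y. lpw_norm p w (\<lambda>n. x n - y n))"

definition lin_on :: "cseq set \<Rightarrow> (cseq \<Rightarrow> cseq) \<Rightarrow> bool" where
  "lin_on V T \<longleftrightarrow>
     (\<forall>x\<in>V. \<forall>y\<in>V. T (\<lambda>n. x n + y n) = (\<lambda>n. T x n + T y n)) \<and>
     (\<forall>c. \<forall>x\<in>V. T (\<lambda>n. c * x n) = (\<lambda>n. c * T x n))"

text \<open>\<open>continuous_map X X T\<close> includes that \<open>T\<close> maps the carrier into itself.\<close>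

definition cont_lin_ops :: "cseq topology \<Rightarrow> (cseq \<Rightarrow> cseq) set" where
  "cont_lin_ops X = {T. lin_on (topspace X) T \<and> continuous_map X X T}"

definition invertible_op :: "cseq topology \<Rightarrow> (cseq \<Rightarrow> cseq) \<Rightarrow> bool" where
  "invertible_op X T \<longleftrightarrow>
     T \<in> cont_lin_ops X \<and>
     (\<exists>S\<in>cont_lin_ops X. \<forall>x\<in>topspace X. S (T x) = x \<and> T (S x) = x)"

definition shift_op :: "(cseq \<Rightarrow> cseq) \<Rightarrow> complex \<Rightarrow> cseq \<Rightarrow> cseq" where
  "shift_op T \<mu> x = (\<lambda>n. T x n - \<mu> * x n)"

definition spec :: "(cseq \<Rightarrow> cseq) \<Rightarrow> cseq topology \<Rightarrow> complex set" where
  "spec T X = {\<mu>. \<not> invertible_op X (shift_op T \<mu>)}"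

definition point_spec :: "(cseq \<Rightarrow> cseq) \<Rightarrow> cseq topology \<Rightarrow> complex set" where
  "point_spec T X = {\<mu>. \<not> inj_on (shift_op T \<mu>) (topspace X)}"

definition cont_spec :: "(cseq \<Rightarrow> cseq) \<Rightarrow> cseq topology \<Rightarrow> complex set" where
  "cont_spec T X = {\<mu>. inj_on (shift_op T \<mu>) (topspace X) \<and>
     shift_op T \<mu> ` topspace X \<noteq> topspace X \<and>
     X closure_of (shift_op T \<mu> ` topspace X) = topspace X}"

definition resid_spec :: "(cseq \<Rightarrow> cseq) \<Rightarrow> cseq topology \<Rightarrow> complex set" where
  "resid_spec T X = {\<mu>. inj_on (shift_op T \<mu>) (topspace X) \<and>
     X closure_of (shift_op T \<mu> ` topspace X) \<noteq> topspace X}"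

text \<open>Extended-valued, so that an unbounded operator gets norm \<open>\<infinity>\<close> rather than an unspecified
  real supremum.\<close>

definition lpw_opnorm :: "real \<Rightarrow> (nat \<Rightarrow> real) \<Rightarrow> (cseq \<Rightarrow> cseq) \<Rightarrow> ennreal" where
  "lpw_opnorm p w T = (SUP x\<in>{x\<in>lpw p w. lpw_norm p w x \<le> 1}. ennreal (lpw_norm p w (T x)))"

definition lpw_compact_op :: "real \<Rightarrow> (nat \<Rightarrow> real) \<Rightarrow> (cseq \<Rightarrow> cseq) \<Rightarrow> bool" where
  "lpw_compact_op p w T \<longleftrightarrow>
     T \<in> cont_lin_ops (lpw_top p w) \<and>
     compactin (lpw_top p w)
       (lpw_top p w closure_of (T ` {x\<in>lpw p w. lpw_norm p w x \<le> 1}))"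

end

theory Submission
  imports Defs
begin

text \<open>Write \<open>D\<close> for the diagonal operator with entries \<open>1 / (n + 1)\<close> and \<open>R\<close> for the right shift. Then
  \<open>cesaro t = D \<circ> G\<close> with \<open>G = (I - t R)\<inverse>\<close>, the operator \<open>geom_sum t\<close>. Since \<open>w\<close> decreases, \<open>R\<close> is a
  contraction, so \<open>G\<close> is bounded by \<open>1 / (1 - t)\<close>; since \<open>D\<close> has entries of modulus at most 1 that
  tend to 0, \<open>cesaro t\<close> obeys the same bound and is compact.

  All norm estimates rest on one principle (\<open>lpw_recursion_bound\<close>): a sequence with
  \<open>\<bar>u (n + 1)\<bar> \<le> r \<bar>u n\<bar> + \<bar>b (n + 1)\<bar>\<close>, \<open>\<bar>u 0\<bar> \<le> \<bar>b 0\<bar>\<close> and \<open>r < 1\<close>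
  satisfies \<open>\<parallel>u\<parallel> \<le> r \<parallel>R u\<parallel> + \<parallel>b\<parallel> \<le> r \<parallel>u\<parallel> + \<parallel>b\<parallel>\<close>,
  hence \<open>\<parallel>u\<parallel> \<le> \<parallel>b\<parallel> / (1 - r)\<close>. If the coefficient in front of \<open>\<bar>u n\<bar>\<close> is
  bounded and only eventually at most \<open>r\<close>, the bound persists with a larger constant
  (\<open>lpw_eventual_recursion_bound\<close>).

  For the spectrum, the relation \<open>G x = D\<inverse> (y + \<mu> x)\<close>, which is equivalent to
  \<open>cesaro t x - \<mu> x = y\<close>, becomes a first-order recursion for \<open>x\<close> after applying \<open>I - t R\<close>. Its leading
  coefficient is \<open>1 - (n + 1) \<mu>\<close>, so for \<open>\<mu> \<notin> Lam\<close> there is exactly one solution in the space of all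
  sequences (\<open>shift_cesaro_eq_iff\<close>). There are three cases.
  \<^item> For \<open>\<mu> = 1 / (m + 1)\<close> the sequence \<open>(n choose m) t ^ (n - m)\<close> is an eigenvector in the space.
  \<^item> For \<open>\<mu> \<notin> Lam \<union> {0}\<close> the coefficient of \<open>x n\<close> in the recursion for \<open>x (n + 1)\<close> tends to \<open>t < 1\<close> in
    modulus, so the solution operator is bounded and inverts \<open>cesaro t - \<mu>\<close>.
  \<^item> For \<open>\<mu> = 0\<close> the solution of a finitely supported \<open>y\<close> is finitely supported, so the range is dense;
    but \<open>y\<close> lies in the range only if \<open>(n + 1) y n\<close> lies in the space, which fails for suitable \<open>y\<close>.\<close>

section \<open>Weighted sequence spaces\<close>

lemma convex_on_powr_nonneg:
  assumes "1 \<le> (p::real)"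
  shows "convex_on {0..} (\<lambda>x::real. x powr p)"
proof (rule convex_onI)
  fix s x y :: real
  assume s: "0 < s" "s < 1" and "x \<in> {0..}" "y \<in> {0..}"
  then have xy: "0 \<le> x" "0 \<le> y" by auto
  have zero: "(c * z) powr p \<le> c * z powr p" if "0 < c" "c < 1" "0 \<le> z" for c z :: real
  proof -
    have "c powr p \<le> c powr 1"
      by (rule powr_mono') (use that assms in auto)
    with that show ?thesis
      by (simp add: powr_mult mult_right_mono)
  qed
  show "((1 - s) *\<^sub>R x + s *\<^sub>R y) powr p \<le> (1 - s) * x powr p + s * y powr p"
  proof (cases "0 < x \<and> 0 < y")
    case True
    with convex_onD[OF powr_convex[OF assms], of s x y] s show ?thesis
      by simp
  next
    case False
    then consider "x = 0" | "y = 0" using xy by force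
    then show ?thesis
      using zero[of s y] zero[of "1 - s" x] s xy assms by cases auto
  qed
qed simp

text \<open>Apply convexity to \<open>(x + y) / (a + b)\<close>, the combination of \<open>x / a\<close> and \<open>y / b\<close> with weights
  \<open>a / (a + b)\<close> and \<open>b / (a + b)\<close>. With \<open>a\<close> and \<open>b\<close> the norms of two sequences, summing this over the
  entries gives Minkowski's inequality.\<close>

lemma add_powr_le_convex_combination:
  fixes a b p x y :: real
  assumes "1 \<le> p" "0 < a" "0 < b" "0 \<le> x" "0 \<le> y"
  shows "(x + y) powr p
    \<le> (a + b) powr p * (a / (a + b) * (x powr p / a powr p) + b / (a + b) * (y powr p / b powr p))"
proof -
  have s: "1 - b / (a + b) = a / (a + b)"
    using assms by (simp add: field_simps)
  have "(a / (a + b) * (x / a) + b / (a + b) * (y / b)) powr p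
      \<le> a / (a + b) * (x / a) powr p + b / (a + b) * (y / b) powr p"
    using convex_onD[OF convex_on_powr_nonneg[OF assms(1)], of "b / (a + b)" "x / a" "y / b"] assms
    by (simp add: s)
  moreover have "a / (a + b) * (x / a) + b / (a + b) * (y / b) = (x + y) / (a + b)"
    using assms by (simp add: add_divide_distrib)
  ultimately have "((x + y) / (a + b)) powr p
      \<le> a / (a + b) * (x powr p / a powr p) + b / (a + b) * (y powr p / b powr p)"
    using assms by (simp only: powr_divide less_imp_le)
  moreover have "(x + y) powr p = (a + b) powr p * ((x + y) / (a + b)) powr p"
    using assms by (simp add: powr_divide)
  ultimately show ?thesis
    by (simp only: mult_left_mono powr_ge_zero)
qed

definition truncate_seq :: "nat \<Rightarrow> cseq \<Rightarrow> cseq" where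
  "truncate_seq m x = (\<lambda>n. if n < m then x n else 0)"

locale weighted_lp =
  fixes p :: real and w :: "nat \<Rightarrow> real"
  assumes p_ge_1: "1 \<le> p" and w_pos: "\<And>n. 0 < w n"
begin

lemma p_pos: "0 < p"
  using p_ge_1 by simp

lemma term_nonneg: "0 \<le> cmod (x n) powr p * w n"
  using w_pos[of n] by simp

lemma lpw_norm_nonneg: "0 \<le> lpw_norm p w x"
  by (simp add: lpw_norm_def)

lemma lpw_norm_powr:
  assumes "x \<in> lpw p w"
  shows "lpw_norm p w x powr p = (\<Sum>n. cmod (x n) powr p * w n)"
  using assms p_pos term_nonneg
  by (simp add: lpw_norm_def lpw_def powr_powr suminf_nonneg)

lemma lpw_norm_le_iff:
  assumes "x \<in> lpw p w" "0 \<le> c"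
  shows "lpw_norm p w x \<le> c \<longleftrightarrow> (\<Sum>n. cmod (x n) powr p * w n) \<le> c powr p"
proof -
  have "lpw_norm p w x \<le> c \<longleftrightarrow> lpw_norm p w x powr p \<le> c powr p"
    using p_pos assms lpw_norm_nonneg[of x]
    by (meson not_le powr_less_mono2 powr_mono2 less_imp_le)
  with lpw_norm_powr[OF assms(1)] show ?thesis by simp
qed

lemma lpw_partial_sum_le:
  assumes "x \<in> lpw p w"
  shows "(\<Sum>n<m. cmod (x n) powr p * w n) \<le> lpw_norm p w x powr p"
  unfolding lpw_norm_powr[OF assms]
  by (rule sum_le_suminf) (use assms term_nonneg in \<open>auto simp: lpw_def\<close>)

text \<open>Membership and the norm bound come together from the partial sums, so that later estimates never
  have to establish summability separately.\<close>

lemma lpw_of_bounded_partial_sums: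
  assumes "0 \<le> c" "\<And>m. (\<Sum>n<m. cmod (x n) powr p * w n) \<le> c powr p"
  shows "x \<in> lpw p w" "lpw_norm p w x \<le> c"
proof -
  have "summable (\<lambda>n. cmod (x n) powr p * w n)"
    by (rule summableI_nonneg_bounded[where x = "c powr p"]) (use assms term_nonneg in auto)
  then show mem: "x \<in> lpw p w" by (simp add: lpw_def)
  with assms show "lpw_norm p w x \<le> c"
    by (simp add: lpw_norm_le_iff suminf_le_const lpw_def)
qed

lemma lpw_dominated:
  assumes "y \<in> lpw p w" "\<And>n. cmod (x n) \<le> cmod (y n)"
  shows "x \<in> lpw p w" "lpw_norm p w x \<le> lpw_norm p w y"
proof -
  have "(\<Sum>n<m. cmod (x n) powr p * w n) \<le> lpw_norm p w y powr p" for m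
  proof -
    have "(\<Sum>n<m. cmod (x n) powr p * w n) \<le> (\<Sum>n<m. cmod (y n) powr p * w n)"
      using assms(2) p_pos w_pos
      by (intro sum_mono mult_right_mono powr_mono2) (auto simp: less_imp_le)
    also have "\<dots> \<le> lpw_norm p w y powr p"
      by (rule lpw_partial_sum_le[OF assms(1)])
    finally show ?thesis .
  qed
  then show "x \<in> lpw p w" "lpw_norm p w x \<le> lpw_norm p w y"
    using lpw_of_bounded_partial_sums[OF lpw_norm_nonneg] by blast+
qed

lemma lpw_scale:
  assumes "x \<in> lpw p w"
  shows "(\<lambda>n. c * x n) \<in> lpw p w" "lpw_norm p w (\<lambda>n. c * x n) = cmod c * lpw_norm p w x"
proof -
  have eq: "(\<lambda>n. cmod (c * x n) powr p * w n) = (\<lambda>n. cmod c powr p * (cmod (x n) powr p * w n))"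
    by (simp add: norm_mult powr_mult mult.assoc)
  have sm: "summable (\<lambda>n. cmod (x n) powr p * w n)"
    using assms by (simp add: lpw_def)
  then show "(\<lambda>n. c * x n) \<in> lpw p w"
    unfolding lpw_def mem_Collect_eq eq by (rule summable_mult)
  show "lpw_norm p w (\<lambda>n. c * x n) = cmod c * lpw_norm p w x"
    unfolding lpw_norm_def eq suminf_mult[OF sm]
    using p_pos suminf_nonneg[OF sm] term_nonneg by (simp add: powr_mult powr_powr)
qed

lemma coordinate_le_lpw_norm:
  assumes "x \<in> lpw p w"
  shows "cmod (x n) \<le> lpw_norm p w x / w n powr (1 / p)"
proof -
  have "cmod (x n) powr p * w n \<le> (\<Sum>k<Suc n. cmod (x k) powr p * w k)"
    by (rule member_le_sum) (use term_nonneg in auto)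
  also have "\<dots> \<le> lpw_norm p w x powr p"
    by (rule lpw_partial_sum_le[OF assms])
  finally have "(cmod (x n) powr p * w n) powr (1 / p) \<le> (lpw_norm p w x powr p) powr (1 / p)"
    by (intro powr_mono2) (use p_pos term_nonneg in auto)
  then have "cmod (x n) * w n powr (1 / p) \<le> lpw_norm p w x"
    using p_pos w_pos[of n] lpw_norm_nonneg[of x] by (simp add: powr_mult powr_powr)
  then show ?thesis
    using w_pos[of n] by (simp add: field_simps)
qed

lemma lpw_norm_eq_0_iff:
  assumes "x \<in> lpw p w"
  shows "lpw_norm p w x = 0 \<longleftrightarrow> x = (\<lambda>n. 0)"
proof
  assume "lpw_norm p w x = 0"
  with coordinate_le_lpw_norm[OF assms] show "x = (\<lambda>n. 0)" by auto
qed (use p_pos in \<open>simp add: lpw_norm_def\<close>)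

text \<open>Minkowski's inequality. The convexity estimate divides by both norms, so a vanishing norm is treated
  separately.\<close>

lemma lpw_add:
  assumes x: "x \<in> lpw p w" and y: "y \<in> lpw p w"
  shows "(\<lambda>n. x n + y n) \<in> lpw p w"
    "lpw_norm p w (\<lambda>n. x n + y n) \<le> lpw_norm p w x + lpw_norm p w y"
proof -
  have "(\<lambda>n. x n + y n) \<in> lpw p w \<and>
    lpw_norm p w (\<lambda>n. x n + y n) \<le> lpw_norm p w x + lpw_norm p w y"
  proof (cases "lpw_norm p w x = 0 \<or> lpw_norm p w y = 0")
    case True
    then show ?thesis
      using x y lpw_norm_nonneg lpw_norm_eq_0_iff by auto
  next
    case False
    define a where "a = lpw_norm p w x"
    define b where "b = lpw_norm p w y"
    have ab: "0 < a" "0 < b"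
      using False lpw_norm_nonneg[of x] lpw_norm_nonneg[of y] by (auto simp: a_def b_def)
    have "(\<Sum>n<m. cmod (x n + y n) powr p * w n) \<le> (a + b) powr p" for m
    proof -
      let ?X = "\<Sum>n<m. cmod (x n) powr p * w n" and ?Y = "\<Sum>n<m. cmod (y n) powr p * w n"
      have "(\<Sum>n<m. cmod (x n + y n) powr p * w n) \<le> (\<Sum>n<m. (a + b) powr p *
        (a / (a + b) * (cmod (x n) powr p / a powr p) + b / (a + b) * (cmod (y n) powr p / b powr p)) * w n)"
      proof (rule sum_mono)
        fix n
        have "cmod (x n + y n) powr p \<le> (cmod (x n) + cmod (y n)) powr p"
          using p_pos by (intro powr_mono2 norm_triangle_ineq) auto
        also have "\<dots> \<le> (a + b) powr p *
          (a / (a + b) * (cmod (x n) powr p / a powr p) + b / (a + b) * (cmod (y n) powr p / b powr p))"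
          by (rule add_powr_le_convex_combination[OF p_ge_1 ab]) auto
        finally show "cmod (x n + y n) powr p * w n \<le> (a + b) powr p *
          (a / (a + b) * (cmod (x n) powr p / a powr p) + b / (a + b) * (cmod (y n) powr p / b powr p)) * w n"
          using w_pos[of n] by (intro mult_right_mono) auto
      qed
      also have "\<dots> = (a + b) powr p * (a / (a + b) * (?X / a powr p) + b / (a + b) * (?Y / b powr p))"
        by (simp add: sum_distrib_left sum_divide_distrib sum.distrib[symmetric] algebra_simps)
      also have "\<dots> \<le> (a + b) powr p * (a / (a + b) * 1 + b / (a + b) * 1)"
        using ab lpw_partial_sum_le[OF x, of m] lpw_partial_sum_le[OF y, of m]
        by (intro mult_left_mono add_mono) (auto simp: a_def[symmetric] b_def[symmetric])
      also have "\<dots> = (a + b) powr p"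
        using ab by (simp add: add_divide_distrib[symmetric])
      finally show ?thesis .
    qed
    then show ?thesis
      using lpw_of_bounded_partial_sums[of "a + b" "\<lambda>n. x n + y n"] ab by (simp add: a_def b_def)
  qed
  then show "(\<lambda>n. x n + y n) \<in> lpw p w"
    "lpw_norm p w (\<lambda>n. x n + y n) \<le> lpw_norm p w x + lpw_norm p w y"
    by blast+
qed

lemma lpw_diff:
  assumes x: "x \<in> lpw p w" and y: "y \<in> lpw p w"
  shows "(\<lambda>n. x n - y n) \<in> lpw p w"
    "lpw_norm p w (\<lambda>n. x n - y n) \<le> lpw_norm p w x + lpw_norm p w y"
  using lpw_add[OF x lpw_scale(1)[OF y, of "-1"]] lpw_scale(2)[OF y, of "-1"] by auto

sublocale lp: Metric_space "lpw p w" "\<lambda>x y. lpw_norm p w (\<lambda>n. x n - y n)"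
proof
  fix x y z :: cseq
  show "0 \<le> lpw_norm p w (\<lambda>n. x n - y n)" by (rule lpw_norm_nonneg)
  show "lpw_norm p w (\<lambda>n. x n - y n) = lpw_norm p w (\<lambda>n. y n - x n)"
    by (simp add: lpw_norm_def norm_minus_commute)
  show "lpw_norm p w (\<lambda>n. x n - y n) = 0 \<longleftrightarrow> x = y" if "x \<in> lpw p w" "y \<in> lpw p w"
    using lpw_norm_eq_0_iff[OF lpw_diff(1)[OF that]] by (auto simp: fun_eq_iff)
  show "lpw_norm p w (\<lambda>n. x n - z n) \<le> lpw_norm p w (\<lambda>n. x n - y n) + lpw_norm p w (\<lambda>n. y n - z n)"
    if "x \<in> lpw p w" "y \<in> lpw p w" "z \<in> lpw p w"
    using lpw_add(2)[OF lpw_diff(1)[OF that(1,2)] lpw_diff(1)[OF that(2,3)]] by simp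
qed

lemma lpw_top_eq: "lpw_top p w = lp.mtopology"
  by (simp add: lpw_top_def)

lemma topspace_lpw_top: "topspace (lpw_top p w) = lpw p w"
  by (simp add: lpw_top_eq)

lemma lin_on_diff:
  assumes "lin_on (lpw p w) T" "x \<in> lpw p w" "y \<in> lpw p w"
  shows "T (\<lambda>n. x n - y n) = (\<lambda>n. T x n - T y n)"
proof -
  have "T (\<lambda>n. x n + (-1) * y n) = (\<lambda>n. T x n + T (\<lambda>n. (-1) * y n) n)"
    using assms(1,2) lpw_scale(1)[OF assms(3), of "-1"] unfolding lin_on_def by metis
  moreover have "T (\<lambda>n. (-1) * y n) = (\<lambda>n. (-1) * T y n)"
    using assms unfolding lin_on_def by blast
  ultimately show ?thesis by simp
qed

lemma bounded_linear_in_cont_lin_ops: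
  assumes lin: "lin_on (lpw p w) T"
    and bd: "\<And>x. x \<in> lpw p w \<Longrightarrow> T x \<in> lpw p w \<and> lpw_norm p w (T x) \<le> K * lpw_norm p w x"
  shows "T \<in> cont_lin_ops (lpw_top p w)"
proof -
  have "continuous_map lp.mtopology lp.mtopology T"
    unfolding lp.metric_continuous_map[OF lp.Metric_space_axioms]
  proof (intro conjI ballI allI impI)
    show "T ` lpw p w \<subseteq> lpw p w" using bd by blast
    fix a and e :: real
    assume a: "a \<in> lpw p w" and e: "0 < e"
    define L where "L = max K 1"
    have L: "K \<le> L" "0 < L" by (auto simp: L_def)
    have "lpw_norm p w (\<lambda>n. T a n - T x n) < e"
      if "x \<in> lpw p w \<and> lpw_norm p w (\<lambda>n. a n - x n) < e / L" for x
    proof -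
      have "lpw_norm p w (\<lambda>n. T a n - T x n) \<le> K * lpw_norm p w (\<lambda>n. a n - x n)"
        using lin_on_diff[OF lin, of a x] bd[OF lpw_diff(1)[of a x]] a that by simp
      also have "\<dots> \<le> L * lpw_norm p w (\<lambda>n. a n - x n)"
        using L lpw_norm_nonneg by (intro mult_right_mono) auto
      also have "\<dots> < e"
        using that L by (simp add: field_simps)
      finally show ?thesis .
    qed
    then show "\<exists>d>0. \<forall>x. x \<in> lpw p w \<and> lpw_norm p w (\<lambda>n. a n - x n) < d
        \<longrightarrow> lpw_norm p w (\<lambda>n. T a n - T x n) < e"
      using e L by (intro exI[of _ "e / L"]) auto
  qed
  with lin show ?thesis
    by (simp add: cont_lin_ops_def lpw_top_eq)
qed

lemma truncate_seq_lpw: "truncate_seq m x \<in> lpw p w"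
  unfolding lpw_def mem_Collect_eq
  by (rule summable_finite[of "{..<m}"]) (use p_pos in \<open>auto simp: truncate_seq_def\<close>)

lemma lpw_norm_truncate_powr:
  "lpw_norm p w (truncate_seq m x) powr p = (\<Sum>n<m. cmod (x n) powr p * w n)"
proof -
  have "(\<Sum>n. cmod (truncate_seq m x n) powr p * w n) = (\<Sum>n<m. cmod (truncate_seq m x n) powr p * w n)"
    by (rule suminf_finite) (use p_pos in \<open>auto simp: truncate_seq_def\<close>)
  also have "\<dots> = (\<Sum>n<m. cmod (x n) powr p * w n)"
    by (rule sum.cong) (auto simp: truncate_seq_def)
  finally show ?thesis
    using lpw_norm_powr[OF truncate_seq_lpw] by simp
qed

text \<open>Truncations always lie in the space, so an inequality between norms such as
  \<open>\<parallel>u\<parallel> \<le> r \<parallel>u\<parallel> + c\<close> may be solved for the norm of a truncation before \<open>u\<close> is known to have finite norm.\<close>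

lemma lpw_of_bounded_truncations:
  assumes "\<And>m. lpw_norm p w (truncate_seq m x) \<le> c"
  shows "x \<in> lpw p w" "lpw_norm p w x \<le> c"
proof -
  have c: "0 \<le> c" using assms lpw_norm_nonneg order_trans by blast
  have "(\<Sum>n<m. cmod (x n) powr p * w n) \<le> c powr p" for m
    using assms[of m] lpw_norm_nonneg p_pos
    by (simp flip: lpw_norm_truncate_powr add: powr_mono2)
  then show "x \<in> lpw p w" "lpw_norm p w x \<le> c"
    using lpw_of_bounded_partial_sums[OF c] by blast+
qed

lemma truncate_seq_tendsto:
  assumes x: "x \<in> lpw p w"
  shows "(\<lambda>m. lpw_norm p w (\<lambda>n. x n - truncate_seq m x n)) \<longlonglongrightarrow> 0"
proof -
  let ?f = "\<lambda>n. cmod (x n) powr p * w n"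
  have sm: "summable ?f" using x by (simp add: lpw_def)
  have "(\<Sum>n. cmod (x n - truncate_seq m x n) powr p * w n) = (\<Sum>n. ?f n) - (\<Sum>n<m. ?f n)" for m
  proof -
    have eq: "cmod (x n - truncate_seq m x n) powr p * w n
        = ?f n - cmod (truncate_seq m x n) powr p * w n" for n
      using p_pos by (simp add: truncate_seq_def)
    show ?thesis
      unfolding eq using lpw_norm_powr[OF truncate_seq_lpw, of m x] truncate_seq_lpw[of m x] sm
      by (subst suminf_diff[symmetric]) (auto simp: lpw_norm_truncate_powr lpw_def)
  qed
  moreover have "(\<lambda>m. (\<Sum>n. ?f n) - (\<Sum>n<m. ?f n)) \<longlonglongrightarrow> (\<Sum>n. ?f n) - (\<Sum>n. ?f n)"
    by (intro tendsto_diff tendsto_const summable_LIMSEQ[OF sm])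
  ultimately have "(\<lambda>m. \<Sum>n. cmod (x n - truncate_seq m x n) powr p * w n) \<longlonglongrightarrow> 0"
    by simp
  then have "(\<lambda>m. (\<Sum>n. cmod (x n - truncate_seq m x n) powr p * w n) powr (1 / p)) \<longlonglongrightarrow> 0 powr (1 / p)"
    by (rule tendsto_powr2[OF _ tendsto_const]) (use p_pos term_nonneg lpw_diff(1)[OF x truncate_seq_lpw] in
      \<open>auto intro!: always_eventually suminf_nonneg simp: lpw_def\<close>)
  then show ?thesis by (simp add: lpw_norm_def)
qed

end

section \<open>Norm bounds from first-order recursions\<close>

locale decreasing_weighted_lp = weighted_lp +
  assumes w_decseq: "decseq w"
begin

lemma lpw_right_shift:
  assumes x: "x \<in> lpw p w"
  shows "(\<lambda>n. case n of 0 \<Rightarrow> 0 | Suc k \<Rightarrow> x k) \<in> lpw p w"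
    "lpw_norm p w (\<lambda>n. case n of 0 \<Rightarrow> 0 | Suc k \<Rightarrow> x k) \<le> lpw_norm p w x"
proof -
  let ?y = "\<lambda>n. case n of 0 \<Rightarrow> 0 | Suc k \<Rightarrow> x k"
  have "(\<Sum>n<m. cmod (?y n) powr p * w n) \<le> lpw_norm p w x powr p" for m
  proof (cases m)
    case (Suc k)
    have "(\<Sum>n<m. cmod (?y n) powr p * w n) = (\<Sum>n<k. cmod (x n) powr p * w (Suc n))"
      using p_pos unfolding Suc by (subst sum.lessThan_Suc_shift) simp
    also have "\<dots> \<le> (\<Sum>n<k. cmod (x n) powr p * w n)"
      using w_decseq by (intro sum_mono mult_left_mono) (auto simp: decseq_Suc_iff)
    also have "\<dots> \<le> lpw_norm p w x powr p"
      by (rule lpw_partial_sum_le[OF x])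
    finally show ?thesis .
  qed simp
  then show "?y \<in> lpw p w" "lpw_norm p w ?y \<le> lpw_norm p w x"
    using lpw_of_bounded_partial_sums[OF lpw_norm_nonneg] by blast+
qed

text \<open>Truncation preserves the recursive inequality. For a truncation \<open>v\<close> of \<open>u\<close> the contraction property
  of the right shift and Minkowski's inequality give \<open>\<parallel>v\<parallel> \<le> r \<parallel>v\<parallel> + \<parallel>b\<parallel>\<close>, with all norms finite.\<close>

lemma lpw_recursion_bound:
  assumes r: "0 \<le> r" "r < 1" and b: "b \<in> lpw p w"
    and u0: "cmod (u 0) \<le> cmod (b 0)"
    and uSuc: "\<And>n. cmod (u (Suc n)) \<le> r * cmod (u n) + cmod (b (Suc n))"
  shows "u \<in> lpw p w" "lpw_norm p w u \<le> lpw_norm p w b / (1 - r)"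
proof -
  have "lpw_norm p w (truncate_seq m u) \<le> lpw_norm p w b / (1 - r)" for m
  proof -
    let ?v = "truncate_seq m u"
    let ?s = "\<lambda>n. case n of 0 \<Rightarrow> 0 | Suc k \<Rightarrow> ?v k"
    let ?g = "\<lambda>n. of_real r * of_real (cmod (?s n)) + of_real (cmod (b n)) :: complex"
    have v: "?v \<in> lpw p w" by (rule truncate_seq_lpw)
    note s = lpw_right_shift[OF v]
    have s': "(\<lambda>n. of_real (cmod (?s n)) :: complex) \<in> lpw p w"
      "lpw_norm p w (\<lambda>n. of_real (cmod (?s n))) \<le> lpw_norm p w ?s"
      using lpw_dominated[OF s(1), of "\<lambda>n. of_real (cmod (?s n))"] by auto
    have b': "(\<lambda>n. of_real (cmod (b n)) :: complex) \<in> lpw p w"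
      "lpw_norm p w (\<lambda>n. of_real (cmod (b n))) \<le> lpw_norm p w b"
      using lpw_dominated[OF b, of "\<lambda>n. of_real (cmod (b n))"] by auto
    note rs = lpw_scale[OF s'(1), of "of_real r"]
    have "cmod (?v n) \<le> cmod (?g n)" for n
    proof -
      have g: "cmod (?g n) = r * cmod (?s n) + cmod (b n)"
        using r norm_of_real[of "r * cmod (?s n) + cmod (b n)", where 'a = complex] by simp
      show ?thesis
        unfolding g using r u0 uSuc by (cases n) (auto simp: truncate_seq_def)
    qed
    then have "lpw_norm p w ?v \<le> lpw_norm p w ?g"
      by (rule lpw_dominated(2)[OF lpw_add(1)[OF rs(1) b'(1)]])
    also have "\<dots> \<le> r * lpw_norm p w ?v + lpw_norm p w b"
    proof -
      have "lpw_norm p w ?g \<le> r * lpw_norm p w (\<lambda>n. of_real (cmod (?s n))) + lpw_norm p w (\<lambda>n. of_real (cmod (b n)))"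
        using lpw_add(2)[OF rs(1) b'(1)] rs(2) r by simp
      also have "\<dots> \<le> r * lpw_norm p w ?v + lpw_norm p w b"
        using b'(2) order_trans[OF s'(2) s(2)] r by (intro add_mono mult_left_mono) auto
      finally show ?thesis .
    qed
    finally show ?thesis
      using r by (simp add: field_simps)
  qed
  then show "u \<in> lpw p w" "lpw_norm p w u \<le> lpw_norm p w b / (1 - r)"
    using lpw_of_bounded_truncations by blast+
qed

text \<open>The finitely many coefficients above \<open>r\<close> are absorbed by dividing \<open>u n\<close> by a factor that grows
  geometrically for the first \<open>N\<close> steps and is constant from then on; the quotient satisfies the
  recursive inequality with coefficient \<open>r\<close> throughout.\<close>

lemma lpw_eventual_recursion_bound:
  assumes r: "0 < r" "r < 1" and b: "b \<in> lpw p w"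
    and A: "\<And>n. \<alpha> n \<le> A" and N: "\<And>n. N \<le> n \<Longrightarrow> \<alpha> n \<le> r"
    and u0: "cmod (u 0) \<le> cmod (b 0)"
    and uSuc: "\<And>n. cmod (u (Suc n)) \<le> \<alpha> n * cmod (u n) + cmod (b (Suc n))"
  shows "u \<in> lpw p w" "lpw_norm p w u \<le> (max A r / r) ^ N * (lpw_norm p w b / (1 - r))"
proof -
  define B where "B = max A r / r"
  have B: "1 \<le> B" "A \<le> B * r"
    using r by (auto simp: B_def)
  \<comment> \<open>Each of the first \<open>N\<close> steps loses a factor of at most \<open>B\<close> compared with coefficient \<open>r\<close>.\<close>
  define c where "c n = B ^ min n N" for n
  have c: "1 \<le> c n" "c n \<le> B ^ N" for n
    using B by (auto simp: c_def intro: power_increasing)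
  define v where "v n = u n / of_real (c n)" for n
  have cmod_v: "cmod (v n) = cmod (u n) / c n" for n
    using c(1)[of n] by (simp add: v_def norm_divide)
  have step: "\<alpha> n / c (Suc n) \<le> r / c n" for n
  proof (cases "N \<le> n")
    case True
    then have "c (Suc n) = c n" by (simp add: c_def min_def)
    then show ?thesis using N[OF True] c(1)[of n] by (simp add: divide_right_mono)
  next
    case False
    then have "c (Suc n) = B * c n" by (simp add: c_def min_def)
    moreover have "\<alpha> n \<le> B * r" using A[of n] B by simp
    ultimately show ?thesis using c(1)[of n] B by (simp add: field_simps)
  qed
  have "cmod (v (Suc n)) \<le> r * cmod (v n) + cmod (b (Suc n))" for n
  proof -
    have "cmod (v (Suc n)) \<le> (\<alpha> n * cmod (u n) + cmod (b (Suc n))) / c (Suc n)"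
      unfolding cmod_v using uSuc[of n] c(1)[of "Suc n"] by (simp add: divide_right_mono)
    also have "\<dots> = \<alpha> n / c (Suc n) * cmod (u n) + cmod (b (Suc n)) / c (Suc n)"
      by (simp add: add_divide_distrib)
    also have "\<dots> \<le> r / c n * cmod (u n) + cmod (b (Suc n)) / 1"
      using step[of n] c(1)[of "Suc n"]
      by (intro add_mono mult_right_mono divide_left_mono) auto
    finally show ?thesis by (simp add: cmod_v)
  qed
  moreover have "cmod (v 0) \<le> cmod (b 0)"
    using u0 by (simp add: cmod_v c_def)
  ultimately have v: "v \<in> lpw p w" "lpw_norm p w v \<le> lpw_norm p w b / (1 - r)"
    using lpw_recursion_bound[of r b v] r b by auto
  have uv: "cmod (u n) \<le> cmod (of_real (B ^ N) * v n)" for n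
  proof -
    have "cmod (u n) = c n * cmod (v n)" using c(1)[of n] by (simp add: cmod_v)
    also have "\<dots> \<le> B ^ N * cmod (v n)" using c(2) by (intro mult_right_mono) auto
    finally show ?thesis using B by (simp add: norm_mult norm_power)
  qed
  note Bv = lpw_scale[OF v(1), of "of_real (B ^ N)"]
  show "u \<in> lpw p w"
    by (rule lpw_dominated(1)[OF Bv(1) uv])
  have "lpw_norm p w u \<le> B ^ N * lpw_norm p w v"
    using lpw_dominated(2)[OF Bv(1) uv] Bv(2) B by (simp add: norm_power)
  also have "\<dots> \<le> B ^ N * (lpw_norm p w b / (1 - r))"
    using v(2) B by (intro mult_left_mono) auto
  finally show "lpw_norm p w u \<le> (max A r / r) ^ N * (lpw_norm p w b / (1 - r))"
    by (simp add: B_def)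
qed

end

section \<open>The Cesaro operator and its algebraic resolvent\<close>

definition geom_sum :: "real \<Rightarrow> cseq \<Rightarrow> cseq" where
  "geom_sum t x = (\<lambda>n. \<Sum>k=0..n. of_real t ^ (n - k) * x k)"

lemma geom_sum_0 [simp]: "geom_sum t x 0 = x 0"
  by (simp add: geom_sum_def)

lemma geom_sum_Suc: "geom_sum t x (Suc n) = of_real t * geom_sum t x n + x (Suc n)"
  by (simp add: geom_sum_def sum_distrib_left Suc_diff_le mult.assoc)

lemma cesaro_eq_geom_sum: "cesaro t x n = geom_sum t x n / of_nat (n + 1)"
  by (simp add: cesaro_def geom_sum_def)

lemma lin_on_cesaro: "lin_on V (cesaro t)"
  by (simp add: lin_on_def cesaro_def fun_eq_iff sum.distrib distrib_left sum_distrib_left mult.left_commute del: times_divide_eq_left times_divide_eq_right)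

text \<open>The equation \<open>cesaro t x - \<mu> x = y\<close> says \<open>s n = (n + 1) (y n + \<mu> x n)\<close> for \<open>s = geom_sum t x\<close>.
  Substituting this into \<open>s (n + 1) = t s n + x (n + 1)\<close> and solving for \<open>x (n + 1)\<close> gives the recursion.\<close>

primrec cesaro_resolvent :: "real \<Rightarrow> complex \<Rightarrow> cseq \<Rightarrow> cseq" where
  "cesaro_resolvent t \<mu> y 0 = y 0 / (1 - \<mu>)"
| "cesaro_resolvent t \<mu> y (Suc n) =
    (of_nat (n + 2) * y (Suc n) - of_real t * of_nat (n + 1) * (y n + \<mu> * cesaro_resolvent t \<mu> y n))
      / (1 - of_nat (n + 2) * \<mu>)"

lemma not_in_Lam_iff: "\<mu> \<notin> Lam \<longleftrightarrow> (\<forall>n. 1 - of_nat (n + 1) * \<mu> \<noteq> 0)"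
proof -
  have "\<mu> = 1 / of_nat (n + 1) \<longleftrightarrow> 1 - of_nat (n + 1) * \<mu> = 0" for n
    by (simp add: field_simps del: of_nat_Suc of_nat_add)
  then show ?thesis by (auto simp: Lam_def)
qed

lemma shift_cesaro_eq_iff_geom_sum:
  "shift_op (cesaro t) \<mu> x = y \<longleftrightarrow> (\<forall>n. geom_sum t x n = of_nat (n + 1) * (y n + \<mu> * x n))"
proof -
  have "geom_sum t x n / of_nat (n + 1) - \<mu> * x n = y n
      \<longleftrightarrow> geom_sum t x n = of_nat (n + 1) * (y n + \<mu> * x n)" for n
    by (simp add: field_simps del: of_nat_Suc of_nat_add)
  then show ?thesis
    by (simp add: shift_op_def fun_eq_iff cesaro_eq_geom_sum)
qed

text \<open>For \<open>\<mu> \<notin> Lam\<close> no denominator of the recursion vanishes, so on the space of all sequences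
  \<open>cesaro t - \<mu>\<close> is a bijection, including for \<open>\<mu> = 0\<close>.\<close>

lemma shift_cesaro_eq_iff:
  assumes "\<mu> \<notin> Lam"
  shows "shift_op (cesaro t) \<mu> x = y \<longleftrightarrow> x = cesaro_resolvent t \<mu> y"
proof -
  let ?R = "cesaro_resolvent t \<mu> y"
  have nz: "1 - of_nat (n + 1) * \<mu> \<noteq> 0" for n
    using assms not_in_Lam_iff by blast
  have nz0: "1 - \<mu> \<noteq> 0" using nz[of 0] by simp
  have nzS: "1 - of_nat (n + 2) * \<mu> \<noteq> 0" for n using nz[of "Suc n"] by (simp add: add.commute)
  show ?thesis
    unfolding shift_cesaro_eq_iff_geom_sum
  proof
    assume x: "\<forall>n. geom_sum t x n = of_nat (n + 1) * (y n + \<mu> * x n)"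
    have "x n = ?R n" for n
    proof (induction n)
      case 0
      from x have "x 0 = y 0 + \<mu> * x 0" by (metis geom_sum_0 add_0 of_nat_1 mult_1)
      then have "x 0 * (1 - \<mu>) = y 0" by (simp add: algebra_simps)
      with nz0 show ?case by (simp add: nonzero_eq_divide_eq)
    next
      case (Suc n)
      have "of_nat (n + 2) * (y (Suc n) + \<mu> * x (Suc n))
          = of_real t * (of_nat (n + 1) * (y n + \<mu> * x n)) + x (Suc n)"
        using geom_sum_Suc[of t x n] x by (simp del: of_nat_Suc of_nat_add)
      then have "x (Suc n) * (1 - of_nat (n + 2) * \<mu>)
          = of_nat (n + 2) * y (Suc n) - of_real t * of_nat (n + 1) * (y n + \<mu> * x n)"
        by (simp add: algebra_simps del: of_nat_Suc of_nat_add)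
      with nzS[of n] show ?case
        by (simp add: nonzero_eq_divide_eq Suc.IH del: of_nat_Suc of_nat_add)
    qed
    then show "x = ?R" by blast
  next
    assume x: "x = ?R"
    have x0: "x 0 * (1 - \<mu>) = y 0" using nz0 by (simp add: x)
    have xS: "x (Suc n) * (1 - of_nat (n + 2) * \<mu>)
        = of_nat (n + 2) * y (Suc n) - of_real t * of_nat (n + 1) * (y n + \<mu> * x n)" for n
      using nzS[of n] by (simp add: x del: of_nat_Suc of_nat_add)
    have "geom_sum t x n = of_nat (n + 1) * (y n + \<mu> * x n)" for n
    proof (induction n)
      case 0
      show ?case using x0 by (simp add: algebra_simps)
    next
      case (Suc n)
      have "geom_sum t x (Suc n) = of_real t * (of_nat (n + 1) * (y n + \<mu> * x n)) + x (Suc n)"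
        by (simp add: geom_sum_Suc Suc.IH del: of_nat_Suc of_nat_add)
      also have "\<dots> = of_nat (n + 2) * (y (Suc n) + \<mu> * x (Suc n))"
        using xS[of n] by (simp add: algebra_simps del: of_nat_Suc of_nat_add)
      finally show ?case by (simp del: of_nat_Suc of_nat_add)
    qed
    then show "\<forall>n. geom_sum t x n = of_nat (n + 1) * (y n + \<mu> * x n)" by blast
  qed
qed

definition cesaro_eigenvector :: "real \<Rightarrow> nat \<Rightarrow> cseq" where
  "cesaro_eigenvector t m = (\<lambda>n. of_nat (n choose m) * of_real t ^ (n - m))"

lemma cesaro_eigenvector_apply:
  "cesaro_eigenvector t m n = of_nat (n choose m) * of_real t ^ (n - m)"
  by (simp add: cesaro_eigenvector_def)

text \<open>The powers of \<open>t\<close> combine to \<open>t ^ (n - m)\<close>, and what remains is the hockey-stick identity for binomial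
  coefficients.\<close>

lemma geom_sum_cesaro_eigenvector:
  "geom_sum t (cesaro_eigenvector t m) n = of_nat (Suc n choose Suc m) * of_real t ^ (n - m)"
proof (induction n)
  case 0
  show ?case by (cases m) (simp_all add: cesaro_eigenvector_apply)
next
  case (Suc n)
  show ?case
  proof (cases "m \<le> n")
    case True
    then have "cesaro_eigenvector t m (Suc n)
        = of_nat (Suc n choose m) * (of_real t * of_real t ^ (n - m))"
      and "of_real t ^ (Suc n - m) = of_real t * (of_real t ^ (n - m) :: complex)"
      by (simp_all add: cesaro_eigenvector_apply Suc_diff_le)
    then show ?thesis
      unfolding geom_sum_Suc Suc.IH
      by (simp add: algebra_simps)
  next
    case False
    then have "cesaro_eigenvector t m (Suc n) = (if m = Suc n then 1 else 0)"
      by (simp add: cesaro_eigenvector_apply)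
    with False show ?thesis
      unfolding geom_sum_Suc Suc.IH by (auto simp: binomial_eq_0 simp del: binomial_Suc_Suc)
  qed
qed

lemma shift_cesaro_eigenvector:
  "shift_op (cesaro t) (1 / of_nat (m + 1)) (cesaro_eigenvector t m) = (\<lambda>n. 0)"
proof -
  have "geom_sum t (cesaro_eigenvector t m) n
      = of_nat (n + 1) * (0 + 1 / of_nat (m + 1) * cesaro_eigenvector t m n)" for n
  proof -
    have "of_nat (Suc m) * of_nat (Suc n choose Suc m) = (of_nat (Suc n) * of_nat (n choose m) :: complex)"
      by (metis Suc_times_binomial of_nat_mult)
    then show ?thesis
      unfolding geom_sum_cesaro_eigenvector
      unfolding cesaro_eigenvector_apply
      by (simp add: field_simps del: of_nat_Suc of_nat_add binomial_Suc_Suc)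
  qed
  then show ?thesis
    unfolding shift_cesaro_eq_iff_geom_sum by blast
qed

section \<open>Compactness\<close>

context weighted_lp
begin

text \<open>This is compactness in the product topology, the one that the type of sequences carries: the ball is
  cut out by continuous conditions on finitely many coordinates at a time, and each coordinate is
  bounded on it, so Tychonoff's theorem applies.\<close>

lemma compact_lpw_ball: "compact {x \<in> lpw p w. lpw_norm p w x \<le> 1}"
proof -
  let ?P = "{x :: cseq. \<forall>m. (\<Sum>n<m. cmod (x n) powr p * w n) \<le> 1}"
  let ?Q = "PiE UNIV (\<lambda>n. cball (0::complex) (1 / w n powr (1 / p)))"
  have ball_eq: "{x \<in> lpw p w. lpw_norm p w x \<le> 1} = ?P"
  proof (intro equalityI subsetI)
    fix x assume "x \<in> {x \<in> lpw p w. lpw_norm p w x \<le> 1}"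
    then have "x \<in> lpw p w" "lpw_norm p w x powr p \<le> 1"
      using lpw_norm_nonneg p_pos by (auto intro: powr_le1)
    then show "x \<in> ?P" using lpw_partial_sum_le order_trans by blast
  qed (use lpw_of_bounded_partial_sums[of 1] in auto)
  have "continuous_on UNIV (\<lambda>x :: cseq. cmod (x n) powr p * w n)" for n
    by (intro continuous_on_mult continuous_on_powr' continuous_on_norm
        continuous_on_product_coordinates continuous_on_const) (use p_pos in auto)
  then have "closed ?P"
    by (intro closed_Collect_all closed_Collect_le continuous_on_sum continuous_on_const)
  moreover have "compact ?Q"
  proof -
    have "compactin (product_topology (\<lambda>n. euclidean) UNIV) ?Q"
      unfolding compactin_PiE by simp
    then show ?thesis
      by (simp add: euclidean_product_topology)
  qed
  moreover have "?P \<subseteq> ?Q"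
  proof
    fix x assume "x \<in> ?P"
    then have x: "x \<in> lpw p w" "lpw_norm p w x \<le> 1" using ball_eq by auto
    have "cmod (x n) \<le> 1 / w n powr (1 / p)" for n
      using coordinate_le_lpw_norm[OF x(1), of n] divide_right_mono[OF x(2), of "w n powr (1 / p)"]
      by simp
    then show "x \<in> ?Q" by auto
  qed
  ultimately show ?thesis
    unfolding ball_eq using closed_Int_compact[of ?P ?Q] by (simp only: inf.absorb1)
qed

text \<open>A sequence in the unit ball has a pointwise convergent subsequence with limit in the ball. The
  hypothesis turns pointwise into norm convergence of the images, so the image of the ball is itself
  compact and therefore closed.\<close>

lemma compact_op_if_pointwise_null_to_norm_null:
  assumes T: "T \<in> cont_lin_ops (lpw_top p w)"
    and pointwise: "\<And>z c. \<lbrakk>\<And>j. z j \<in> lpw p w \<and> lpw_norm p w (z j) \<le> c; \<And>n. (\<lambda>j. z j n) \<longlonglongrightarrow> 0\<rbrakk>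
      \<Longrightarrow> (\<lambda>j. lpw_norm p w (T (z j))) \<longlonglongrightarrow> 0"
  shows "lpw_compact_op p w T"
proof -
  let ?B = "{x \<in> lpw p w. lpw_norm p w x \<le> 1}"
  have TM: "T x \<in> lpw p w" if "x \<in> lpw p w" for x
    using T that by (auto simp: cont_lin_ops_def continuous_map_def topspace_lpw_top)
  have T_diff: "T (\<lambda>n. x n - y n) = (\<lambda>n. T x n - T y n)" if "x \<in> lpw p w" "y \<in> lpw p w" for x y
    using lin_on_diff[of T x y] T that by (simp add: cont_lin_ops_def topspace_lpw_top)
  have "compactin lp.mtopology (T ` ?B)"
    unfolding lp.compactin_sequentially
  proof (intro conjI allI impI)
    show "T ` ?B \<subseteq> lpw p w" using TM by blast
    fix s :: "nat \<Rightarrow> cseq"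
    assume "range s \<subseteq> T ` ?B"
    then have "\<forall>j. \<exists>x\<in>?B. s j = T x" by blast
    then obtain f where f: "\<And>j. f j \<in> ?B" "\<And>j. s j = T (f j)" by metis
    obtain l r where l: "l \<in> ?B" and r: "strict_mono (r :: nat \<Rightarrow> nat)" and lim: "(f \<circ> r) \<longlonglongrightarrow> l"
      using seq_compactE[OF compact_imp_seq_compact[OF compact_lpw_ball]] f(1) by blast
    have "(\<lambda>j. lpw_norm p w (T (\<lambda>n. f (r j) n - l n))) \<longlonglongrightarrow> 0"
    proof (rule pointwise[of "\<lambda>j n. f (r j) n - l n" 2])
      show "(\<lambda>n. f (r j) n - l n) \<in> lpw p w \<and> lpw_norm p w (\<lambda>n. f (r j) n - l n) \<le> 2" for j
        using lpw_diff[of "f (r j)" l] f(1)[of "r j"] l by auto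
      have "(\<lambda>j. f (r j) n) \<longlonglongrightarrow> l n" for n
        using continuous_on_tendsto_compose[OF continuous_on_product_coordinates lim] by (simp add: o_def)
      then show "(\<lambda>j. f (r j) n - l n) \<longlonglongrightarrow> 0" for n
        by (simp add: LIM_zero)
    qed
    moreover have "T (\<lambda>n. f (r j) n - l n) = (\<lambda>n. T (f (r j)) n - T l n)" for j
      using T_diff f(1)[of "r j"] l by simp
    ultimately have "(\<lambda>j. lpw_norm p w (\<lambda>n. T (f (r j)) n - T l n)) \<longlonglongrightarrow> 0"
      by simp
    then have "limitin lp.mtopology (s \<circ> r) (T l) sequentially"
      using TM f l by (simp add: lp.limit_metric_sequentially lpw_norm_nonneg LIMSEQ_def)
    with l r show "\<exists>l r. l \<in> T ` ?B \<and> strict_mono r \<and> limitin lp.mtopology (s \<circ> r) l sequentially"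
      by (intro exI[of _ "T l"] exI[of _ r]) simp
  qed
  moreover from this have "lp.mtopology closure_of (T ` ?B) = T ` ?B"
    by (intro closure_of_closedin compactin_imp_closedin lp.Hausdorff_space_mtopology)
  ultimately show ?thesis
    using T by (simp add: lpw_compact_op_def lpw_top_eq)
qed

end

context decreasing_weighted_lp
begin

lemma geom_sum_lpw:
  assumes "0 \<le> t" "t < 1" "x \<in> lpw p w"
  shows "geom_sum t x \<in> lpw p w" "lpw_norm p w (geom_sum t x) \<le> lpw_norm p w x / (1 - t)"
proof -
  have "cmod (geom_sum t x (Suc n)) \<le> t * cmod (geom_sum t x n) + cmod (x (Suc n))" for n
    unfolding geom_sum_Suc using norm_triangle_ineq[of "of_real t * geom_sum t x n" "x (Suc n)"] assms(1)
    by (simp add: norm_mult)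
  then show "geom_sum t x \<in> lpw p w" "lpw_norm p w (geom_sum t x) \<le> lpw_norm p w x / (1 - t)"
    using lpw_recursion_bound[OF assms, of "geom_sum t x"] by simp_all
qed

text \<open>From index \<open>m\<close> on, the entries of \<open>geom_sum t x\<close> are divided by at least \<open>m + 1\<close>. The decay in \<open>m\<close> is
  what makes the operator compact; \<open>m = 0\<close> is the bound for the whole operator.\<close>

lemma cesaro_tail_lpw:
  assumes t: "0 \<le> t" "t < 1" and x: "x \<in> lpw p w"
  shows "(\<lambda>n. if n < m then 0 else cesaro t x n) \<in> lpw p w"
    "lpw_norm p w (\<lambda>n. if n < m then 0 else cesaro t x n) \<le> lpw_norm p w x / (1 - t) / (m + 1)"
proof -
  note g = geom_sum_lpw[OF t x]
  note sg = lpw_scale[OF g(1), of "1 / of_nat (m + 1)"]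
  have le: "cmod (if n < m then 0 else cesaro t x n) \<le> cmod (1 / of_nat (m + 1) * geom_sum t x n)" for n
    by (auto simp: cesaro_eq_geom_sum norm_divide norm_mult intro!: divide_left_mono simp del: of_nat_Suc of_nat_add)
  show "(\<lambda>n. if n < m then 0 else cesaro t x n) \<in> lpw p w"
    by (rule lpw_dominated(1)[OF sg(1) le])
  have "lpw_norm p w (\<lambda>n. if n < m then 0 else cesaro t x n) \<le> 1 / (m + 1) * lpw_norm p w (geom_sum t x)"
    using lpw_dominated(2)[OF sg(1) le] sg(2) by (simp add: norm_divide del: of_nat_Suc of_nat_add)
  also have "\<dots> \<le> 1 / (m + 1) * (lpw_norm p w x / (1 - t))"
    using g(2) by (intro mult_left_mono) auto
  finally show "lpw_norm p w (\<lambda>n. if n < m then 0 else cesaro t x n) \<le> lpw_norm p w x / (1 - t) / (m + 1)"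
    by (simp add: mult.commute)
qed

lemma cesaro_lpw:
  assumes "0 \<le> t" "t < 1" "x \<in> lpw p w"
  shows "cesaro t x \<in> lpw p w" "lpw_norm p w (cesaro t x) \<le> lpw_norm p w x / (1 - t)"
  using cesaro_tail_lpw[OF assms, of 0] by simp_all

lemma cesaro_in_cont_lin_ops:
  assumes "0 \<le> t" "t < 1"
  shows "cesaro t \<in> cont_lin_ops (lpw_top p w)"
  by (rule bounded_linear_in_cont_lin_ops[OF lin_on_cesaro, where K = "1 / (1 - t)"])
    (use cesaro_lpw[OF assms] in auto)

lemma cesaro_opnorm_le:
  assumes "0 \<le> t" "t < 1"
  shows "lpw_opnorm p w (cesaro t) \<le> ennreal (inverse (1 - t))"
  unfolding lpw_opnorm_def
proof (intro SUP_least ennreal_leI)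
  fix x assume "x \<in> {x \<in> lpw p w. lpw_norm p w x \<le> 1}"
  then have x: "x \<in> lpw p w" "lpw_norm p w x \<le> 1" by auto
  have "lpw_norm p w (cesaro t x) \<le> lpw_norm p w x / (1 - t)"
    by (rule cesaro_lpw(2)[OF assms x(1)])
  also have "\<dots> \<le> 1 / (1 - t)"
    using x(2) assms by (intro divide_right_mono) auto
  finally show "lpw_norm p w (cesaro t x) \<le> inverse (1 - t)"
    by (simp add: divide_inverse)
qed

text \<open>The tails of the images are small uniformly in \<open>j\<close>, and the head consists of finitely many
  coordinates, each of which tends to 0.\<close>

lemma cesaro_pointwise_null_to_norm_null:
  assumes t: "0 \<le> t" "t < 1"
    and z: "\<And>j. z j \<in> lpw p w \<and> lpw_norm p w (z j) \<le> c" and lim: "\<And>n. (\<lambda>j. z j n) \<longlonglongrightarrow> 0"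
  shows "(\<lambda>j. lpw_norm p w (cesaro t (z j))) \<longlonglongrightarrow> 0"
proof (rule LIMSEQ_I)
  fix e :: real assume e: "0 < e"
  \<comment> \<open>The uniform tail bound \<open>c / ((1 - t) (m + 1))\<close> has to fall below \<open>e / 2\<close>.\<close>
  obtain m :: nat where m: "c / (1 - t) / (e / 2) < m" using reals_Archimedean2 by blast
  have tail: "lpw_norm p w (\<lambda>n. if n < m then 0 else cesaro t (z j) n) < e / 2" for j
  proof -
    have "lpw_norm p w (\<lambda>n. if n < m then 0 else cesaro t (z j) n) \<le> lpw_norm p w (z j) / (1 - t) / (m + 1)"
      using cesaro_tail_lpw(2)[OF t] z by blast
    also have "\<dots> \<le> c / (1 - t) / (m + 1)"
      using z[of j] t by (intro divide_right_mono) auto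
    also have "\<dots> < e / 2"
    proof -
      have "c / (1 - t) < m * (e / 2)"
        using m e by (subst (asm) pos_divide_less_eq) auto
      also have "\<dots> \<le> (m + 1) * (e / 2)" using e by simp
      finally show ?thesis by (subst pos_divide_less_eq) (auto simp: mult.commute)
    qed
    finally show ?thesis .
  qed
  have coord: "(\<lambda>j. cesaro t (z j) n) \<longlonglongrightarrow> 0" for n
  proof -
    have "(\<lambda>j. 1 / of_nat (n + 1) * (\<Sum>k=0..n. of_real t ^ (n - k) * z j k))
        \<longlonglongrightarrow> 1 / of_nat (n + 1) * (\<Sum>k=0..n. of_real t ^ (n - k) * 0)"
      by (intro tendsto_intros lim)
    then show ?thesis by (simp add: cesaro_def)
  qed
  have "(\<lambda>j. (\<Sum>n<m. cmod (cesaro t (z j) n) powr p * w n) powr (1 / p))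
      \<longlonglongrightarrow> (\<Sum>n<m. cmod 0 powr p * w n) powr (1 / p)"
    by (intro tendsto_powr2 tendsto_sum tendsto_mult tendsto_norm coord tendsto_const)
      (use p_pos term_nonneg in \<open>auto intro!: always_eventually sum_nonneg\<close>)
  moreover have "lpw_norm p w (truncate_seq m x) = (\<Sum>n<m. cmod (x n) powr p * w n) powr (1 / p)" for x
    using p_pos lpw_norm_nonneg by (simp flip: lpw_norm_truncate_powr add: powr_powr)
  ultimately have "(\<lambda>j. lpw_norm p w (truncate_seq m (cesaro t (z j)))) \<longlonglongrightarrow> 0"
    using p_pos by simp
  then obtain J where J: "\<And>j. J \<le> j \<Longrightarrow> lpw_norm p w (truncate_seq m (cesaro t (z j))) < e / 2"
    using LIMSEQ_D[of _ 0 "e / 2"] e lpw_norm_nonneg by fastforce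
  have "lpw_norm p w (cesaro t (z j)) < e" if "J \<le> j" for j
  proof -
    have "cesaro t (z j) = (\<lambda>n. truncate_seq m (cesaro t (z j)) n + (if n < m then 0 else cesaro t (z j) n))"
      by (auto simp: truncate_seq_def)
    then have "lpw_norm p w (cesaro t (z j)) \<le> lpw_norm p w (truncate_seq m (cesaro t (z j)))
        + lpw_norm p w (\<lambda>n. if n < m then 0 else cesaro t (z j) n)"
      using lpw_add(2)[OF truncate_seq_lpw cesaro_tail_lpw(1)[OF t], of "z j" m "cesaro t (z j)" m] z by simp
    with J[OF that] tail[of j] show ?thesis by simp
  qed
  then show "\<exists>J. \<forall>j\<ge>J. norm (lpw_norm p w (cesaro t (z j)) - 0) < e"
    using lpw_norm_nonneg by auto
qed

lemma cesaro_compact: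
  assumes "0 \<le> t" "t < 1"
  shows "lpw_compact_op p w (cesaro t)"
  using compact_op_if_pointwise_null_to_norm_null[OF cesaro_in_cont_lin_ops[OF assms]]
    cesaro_pointwise_null_to_norm_null[OF assms] by blast

section \<open>The spectrum\<close>

text \<open>The eigenvectors arise from a unit vector by alternating \<open>geom_sum t\<close> and right shifts: the first
  is \<open>geom_sum t\<close> of the unit vector at 0, and the next one is the right shift of \<open>geom_sum t\<close> of the
  current one. Both operators preserve the space.\<close>

lemma cesaro_eigenvector_lpw:
  assumes "0 \<le> t" "t < 1"
  shows "cesaro_eigenvector t m \<in> lpw p w"
proof (induction m)
  case 0
  have "geom_sum t (truncate_seq 1 (\<lambda>n. 1)) n = cesaro_eigenvector t 0 n" for n
    by (induction n) (simp_all add: geom_sum_Suc truncate_seq_def cesaro_eigenvector_apply)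
  then have "geom_sum t (truncate_seq 1 (\<lambda>n. 1)) = cesaro_eigenvector t 0" by blast
  then show ?case
    using geom_sum_lpw(1)[OF assms truncate_seq_lpw] by metis
next
  case (Suc m)
  have "(\<lambda>n. case n of 0 \<Rightarrow> 0 | Suc k \<Rightarrow> geom_sum t (cesaro_eigenvector t m) k) = cesaro_eigenvector t (Suc m)"
    by (auto simp: fun_eq_iff cesaro_eigenvector_apply[of t "Suc m"] geom_sum_cesaro_eigenvector split: nat.split)
  then show ?case
    using lpw_right_shift(1)[OF geom_sum_lpw(1)[OF assms Suc.IH]] by simp
qed

text \<open>With \<open>q n = (n + 1) / (1 - (n + 1) \<mu>)\<close> and \<open>\<rho> = (n + 1) / (n + 2)\<close>, the recursion for the solution \<open>x\<close>
  reads \<open>x (n + 1) = q (n + 1) (y (n + 1) - t \<rho> (y n + \<mu> x n))\<close>. Here \<open>q\<close> tends to \<open>- 1 / \<mu>\<close>: it is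
  bounded, and the coefficient of \<open>x n\<close> is bounded in modulus by a sequence that tends to \<open>t\<close>.\<close>

lemma cesaro_resolvent_bounded:
  assumes t: "0 \<le> t" "t < 1" and \<mu>: "\<mu> \<notin> Lam" "\<mu> \<noteq> 0"
  obtains K where "\<And>y. y \<in> lpw p w \<Longrightarrow>
    cesaro_resolvent t \<mu> y \<in> lpw p w \<and> lpw_norm p w (cesaro_resolvent t \<mu> y) \<le> K * lpw_norm p w y"
proof -
  define q where "q n = of_nat (n + 1) / (1 - of_nat (n + 1) * \<mu>)" for n
  have nz: "1 - of_nat (n + 1) * \<mu> \<noteq> 0" for n
    using \<mu> not_in_Lam_iff by blast
  have "(\<lambda>n. 1 / (1 / of_nat (Suc n) - \<mu>)) \<longlonglongrightarrow> 1 / (0 - \<mu>)"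
    using \<mu>(2) LIMSEQ_Suc[OF lim_1_over_n] by (intro tendsto_intros) auto
  moreover have "1 / (1 / of_nat (Suc n) - \<mu>) = q n" for n
  proof -
    have "1 / of_nat (Suc n) - \<mu> = (1 - of_nat (n + 1) * \<mu>) / of_nat (n + 1)"
      by (simp add: diff_divide_distrib del: of_nat_Suc)
    then show ?thesis by (simp add: q_def)
  qed
  ultimately have q: "q \<longlonglongrightarrow> - (1 / \<mu>)" by simp
  obtain K where K: "0 < K" "\<And>n. cmod (q n) \<le> K"
    using convergent_imp_Bseq[of q] q by (auto simp: convergent_def Bseq_def)
  define \<alpha> where "\<alpha> n = t * cmod \<mu> * cmod (q (Suc n))" for n
  have "\<alpha> \<longlonglongrightarrow> t * cmod \<mu> * cmod (- (1 / \<mu>))"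
    unfolding \<alpha>_def by (intro tendsto_intros LIMSEQ_Suc q)
  then have \<alpha>: "\<alpha> \<longlonglongrightarrow> t"
    using \<mu>(2) by (simp add: norm_divide)
  \<comment> \<open>Any number strictly between \<open>t\<close> and 1 will do.\<close>
  define r where "r = (t + 1) / 2"
  have r: "0 < r" "r < 1" "t < r" using t by (auto simp: r_def)
  obtain N where N: "\<And>n. N \<le> n \<Longrightarrow> \<alpha> n \<le> r"
    using order_tendstoD(2)[OF \<alpha> r(3)] unfolding eventually_sequentially by (meson less_imp_le)
  define A where "A = t * cmod \<mu> * K"
  have A: "\<alpha> n \<le> A" for n
    unfolding \<alpha>_def A_def using K t by (intro mult_left_mono) auto
  define L where "L = (max A r / r) ^ N / (1 - r)"
  have L: "0 \<le> L" using r by (simp add: L_def)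
  show thesis
  proof (rule that[of "L * (K * 2)"])
    fix y assume y: "y \<in> lpw p w"
    let ?R = "cesaro_resolvent t \<mu> y"
    \<comment> \<open>Collect the inhomogeneous terms of the recursion: they involve \<open>y\<close> and its right shift.\<close>
    let ?s = "\<lambda>n. case n of 0 \<Rightarrow> 0 | Suc k \<Rightarrow> cmod (y k)"
    let ?b = "\<lambda>n. of_real K * (of_real (cmod (y n)) + of_real (?s n)) :: complex"
    have y': "(\<lambda>n. of_real (cmod (y n)) :: complex) \<in> lpw p w"
      "lpw_norm p w (\<lambda>n. of_real (cmod (y n))) \<le> lpw_norm p w y"
      using lpw_dominated[OF y, of "\<lambda>n. of_real (cmod (y n))"] by auto
    have s_eq: "(\<lambda>n. of_real (?s n) :: complex) = (\<lambda>n. case n of 0 \<Rightarrow> 0 | Suc k \<Rightarrow> of_real (cmod (y k)))"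
      by (auto simp: fun_eq_iff split: nat.split)
    note s = lpw_right_shift[OF y'(1), folded s_eq]
    note ys = lpw_add[OF y'(1) s(1)]
    note b = lpw_scale[OF ys(1), of "of_real K"]
    have cmod_b: "cmod (?b n) = K * (cmod (y n) + ?s n)" for n
    proof -
      have "0 \<le> ?s n" by (simp split: nat.split)
      then have "0 \<le> K * (cmod (y n) + ?s n)" using K by simp
      moreover have "?b n = of_real (K * (cmod (y n) + ?s n))" by simp
      ultimately show ?thesis by (metis norm_of_real abs_of_nonneg)
    qed
    have R0: "cmod (?R 0) \<le> cmod (?b 0)"
    proof -
      have "?R 0 = q 0 * y 0" by (simp add: q_def)
      then show ?thesis
        unfolding cmod_b using K(2)[of 0] by (simp add: norm_mult mult_right_mono)
    qed
    have RSuc: "cmod (?R (Suc n)) \<le> \<alpha> n * cmod (?R n) + cmod (?b (Suc n))" for n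
    proof -
      define \<rho> where "\<rho> = real (n + 1) / real (n + 2)"
      have \<rho>: "0 \<le> \<rho>" "\<rho> \<le> 1" by (auto simp: \<rho>_def)
      have tr: "t * \<rho> \<le> t" "t * \<rho> \<le> 1"
        using mult_left_mono[OF \<rho>(2) t(1)] t by auto
      have "of_nat (n + 1) = of_real \<rho> * (of_nat (n + 2) :: complex)"
        unfolding \<rho>_def by (simp del: of_nat_Suc of_nat_add)
      then have "?R (Suc n) = q (Suc n) * (y (Suc n) - of_real (t * \<rho>) * (y n + \<mu> * ?R n))"
        by (simp add: q_def algebra_simps diff_divide_distrib add_divide_distrib del: of_nat_Suc of_nat_add)
      then have "cmod (?R (Suc n)) = cmod (q (Suc n)) * cmod (y (Suc n) - of_real (t * \<rho>) * (y n + \<mu> * ?R n))"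
        by (simp only: norm_mult)
      also have "\<dots> \<le> cmod (q (Suc n)) * (cmod (y (Suc n)) + t * \<rho> * (cmod (y n) + cmod \<mu> * cmod (?R n)))"
      proof (rule mult_left_mono)
        have "cmod (y (Suc n) - of_real (t * \<rho>) * (y n + \<mu> * ?R n))
            \<le> cmod (y (Suc n)) + t * \<rho> * cmod (y n + \<mu> * ?R n)"
          using norm_triangle_ineq4[of "y (Suc n)" "of_real (t * \<rho>) * (y n + \<mu> * ?R n)"] t \<rho>
          by (simp add: norm_mult)
        also have "t * \<rho> * cmod (y n + \<mu> * ?R n) \<le> t * \<rho> * (cmod (y n) + cmod \<mu> * cmod (?R n))"
          using norm_triangle_ineq[of "y n" "\<mu> * ?R n"] t \<rho> by (intro mult_left_mono) (auto simp: norm_mult)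
        finally show "cmod (y (Suc n) - of_real (t * \<rho>) * (y n + \<mu> * ?R n))
            \<le> cmod (y (Suc n)) + t * \<rho> * (cmod (y n) + cmod \<mu> * cmod (?R n))" by simp
      qed simp
      also have "\<dots> \<le> cmod (q (Suc n)) * (cmod (y (Suc n)) + (1 * cmod (y n) + t * (cmod \<mu> * cmod (?R n))))"
        unfolding distrib_left[of "t * \<rho>"]
        by (intro mult_left_mono add_mono mult_right_mono tr) auto
      also have "\<dots> = \<alpha> n * cmod (?R n) + cmod (q (Suc n)) * (cmod (y (Suc n)) + cmod (y n))"
        by (simp add: \<alpha>_def algebra_simps)
      also have "\<dots> \<le> \<alpha> n * cmod (?R n) + K * (cmod (y (Suc n)) + cmod (y n))"
        using K(2) by (intro add_left_mono mult_right_mono) auto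
      finally show ?thesis unfolding cmod_b by simp
    qed
    note R = lpw_eventual_recursion_bound[OF r(1,2) b(1) A N R0 RSuc]
    have "lpw_norm p w ?R \<le> L * lpw_norm p w ?b"
      using R(2) by (simp add: L_def)
    also have "lpw_norm p w ?b \<le> K * (lpw_norm p w y + lpw_norm p w y)"
      using b(2) ys(2) y'(2) s(2) K(1) by simp
    finally have "lpw_norm p w ?R \<le> L * (K * 2) * lpw_norm p w y"
      using L by (simp add: mult_left_mono mult.assoc)
    with R(1) show "?R \<in> lpw p w \<and> lpw_norm p w ?R \<le> L * (K * 2) * lpw_norm p w y"
      by simp
  qed
qed

lemma lin_on_shift_cesaro: "lin_on V (shift_op (cesaro t) \<mu>)"
  using lin_on_cesaro[of V t] by (simp add: lin_on_def shift_op_def fun_eq_iff algebra_simps)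

text \<open>The inverse of a linear bijection is linear.\<close>

lemma lin_on_cesaro_resolvent:
  assumes "\<mu> \<notin> Lam"
  shows "lin_on V (cesaro_resolvent t \<mu>)"
proof -
  let ?T = "shift_op (cesaro t) \<mu>" and ?R = "cesaro_resolvent t \<mu>"
  have TR: "?T (?R y) = y" for y
    using shift_cesaro_eq_iff[OF assms] by blast
  have lin: "?T (\<lambda>n. x n + y n) = (\<lambda>n. ?T x n + ?T y n)" "?T (\<lambda>n. c * x n) = (\<lambda>n. c * ?T x n)" for x y c
    using lin_on_shift_cesaro[of UNIV t \<mu>] unfolding lin_on_def by blast+
  have "?R (\<lambda>n. x n + y n) = (\<lambda>n. ?R x n + ?R y n)" "?R (\<lambda>n. c * x n) = (\<lambda>n. c * ?R x n)" for x y c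
    by (rule shift_cesaro_eq_iff[OF assms, THEN iffD1, symmetric], simp add: lin TR)+
  then show ?thesis by (simp add: lin_on_def)
qed

lemma shift_cesaro_invertible:
  assumes t: "0 \<le> t" "t < 1" and \<mu>: "\<mu> \<notin> Lam" "\<mu> \<noteq> 0"
  shows "invertible_op (lpw_top p w) (shift_op (cesaro t) \<mu>)"
proof -
  have "shift_op (cesaro t) \<mu> \<in> cont_lin_ops (lpw_top p w)"
  proof (rule bounded_linear_in_cont_lin_ops[OF lin_on_shift_cesaro, where K = "1 / (1 - t) + cmod \<mu>"])
    fix x assume x: "x \<in> lpw p w"
    note d = lpw_diff[OF cesaro_lpw(1)[OF t x] lpw_scale(1)[OF x, of \<mu>]]
    show "shift_op (cesaro t) \<mu> x \<in> lpw p w \<and>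
      lpw_norm p w (shift_op (cesaro t) \<mu> x) \<le> (1 / (1 - t) + cmod \<mu>) * lpw_norm p w x"
      using d cesaro_lpw(2)[OF t x] lpw_scale(2)[OF x, of \<mu>]
      by (simp add: shift_op_def distrib_right)
  qed
  moreover obtain K where "\<And>y. y \<in> lpw p w \<Longrightarrow>
    cesaro_resolvent t \<mu> y \<in> lpw p w \<and> lpw_norm p w (cesaro_resolvent t \<mu> y) \<le> K * lpw_norm p w y"
    using cesaro_resolvent_bounded[OF t \<mu>] by blast
  then have "cesaro_resolvent t \<mu> \<in> cont_lin_ops (lpw_top p w)"
    by (rule bounded_linear_in_cont_lin_ops[OF lin_on_cesaro_resolvent[OF \<mu>(1)]])
  moreover have "cesaro_resolvent t \<mu> (shift_op (cesaro t) \<mu> x) = x"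
    "shift_op (cesaro t) \<mu> (cesaro_resolvent t \<mu> x) = x" for x
    using shift_cesaro_eq_iff[OF \<mu>(1), of t x "shift_op (cesaro t) \<mu> x"]
      shift_cesaro_eq_iff[OF \<mu>(1), of t "cesaro_resolvent t \<mu> x" x] by simp_all
  ultimately show ?thesis
    unfolding invertible_op_def by blast
qed

text \<open>The recursion at \<open>\<mu> = 0\<close> involves only two consecutive entries of \<open>y\<close>, so its solution for a truncated
  sequence vanishes eventually. Hence the range contains all truncations.\<close>

lemma cesaro_range_dense:
  assumes t: "0 \<le> t" "t < 1"
  shows "lpw_top p w closure_of (cesaro t ` lpw p w) = lpw p w"
proof -
  have zero: "(0 :: complex) \<notin> Lam" by (simp add: not_in_Lam_iff)
  have trunc: "truncate_seq m x \<in> cesaro t ` lpw p w" for m x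
  proof -
    let ?R = "cesaro_resolvent t 0 (truncate_seq m x)"
    have "?R n = 0" if "Suc m \<le> n" for n
      using that by (cases n) (auto simp: truncate_seq_def)
    then have "?R = truncate_seq (Suc m) ?R"
      by (auto simp: truncate_seq_def fun_eq_iff not_less)
    then have "?R \<in> lpw p w"
      by (metis truncate_seq_lpw)
    moreover have "cesaro t ?R = truncate_seq m x"
      using shift_cesaro_eq_iff[OF zero, of t ?R "truncate_seq m x"] by (simp add: shift_op_def)
    ultimately show ?thesis by (metis imageI)
  qed
  have "\<exists>y\<in>cesaro t ` lpw p w. y \<in> lp.mball x r" if x: "x \<in> lpw p w" and r: "0 < r" for x r
  proof -
    obtain m where "lpw_norm p w (\<lambda>n. x n - truncate_seq m x n) < r"
      using order_tendstoD(2)[OF truncate_seq_tendsto[OF x] r] by (auto simp: eventually_sequentially)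
    then show ?thesis
      using trunc[of m x] x truncate_seq_lpw[of m x] by auto
  qed
  then show ?thesis
    unfolding lpw_top_eq lp.metric_closure_of by auto
qed

text \<open>If \<open>y = cesaro t x\<close> with \<open>x\<close> in the space, then \<open>geom_sum t x n = (n + 1) y n\<close> is in the space as well.
  The witness \<open>y\<close> is chosen such that the terms of its norm series are \<open>(n + 1) powr (- (p + 1))\<close>, which
  are summable, whereas multiplication by \<open>n + 1\<close> turns them into the harmonic series.\<close>

lemma cesaro_not_surj:
  assumes t: "0 \<le> t" "t < 1"
  shows "cesaro t ` lpw p w \<noteq> lpw p w"
proof
  assume surj: "cesaro t ` lpw p w = lpw p w"
  define y :: cseq where "y n = of_real ((real (Suc n) powr (- (p + 1)) / w n) powr (1 / p))" for n
  have y_term: "cmod (y n) powr p * w n = real (Suc n) powr (- (p + 1))" for n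
    using p_pos w_pos[of n] by (simp add: y_def powr_powr)
  have "summable (\<lambda>n. real (Suc n) powr (- (p + 1)))"
    using summable_real_powr_iff[of "- (p + 1)"] p_pos
      summable_Suc_iff[of "\<lambda>n. real n powr (- (p + 1))"] by simp
  then have "y \<in> lpw p w"
    by (simp add: lpw_def y_term)
  then have "y \<in> cesaro t ` lpw p w" by (simp only: surj)
  then obtain x where x: "x \<in> lpw p w" "cesaro t x = y" by auto
  have "cmod (geom_sum t x n) powr p * w n = real (Suc n) powr (- 1)" for n
  proof -
    have "geom_sum t x n = of_nat (n + 1) * y n"
      using x(2)[symmetric] by (simp add: cesaro_eq_geom_sum del: of_nat_Suc of_nat_add)
    then have "cmod (geom_sum t x n) powr p * w n = real (Suc n) powr p * (cmod (y n) powr p * w n)"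
      by (simp add: norm_mult powr_mult del: of_nat_Suc)
    also have "\<dots> = real (Suc n) powr (- 1)"
      unfolding y_term powr_add[symmetric] by simp
    finally show ?thesis .
  qed
  with geom_sum_lpw(1)[OF t x(1)] have "summable (\<lambda>n. real (Suc n) powr (- 1))"
    unfolding lpw_def mem_Collect_eq by (simp del: of_nat_Suc)
  then show False
    using summable_real_powr_iff[of "- 1"] summable_Suc_iff[of "\<lambda>n. real n powr (- 1)"] by simp
qed

lemma shift_cesaro_inj_on_iff:
  assumes t: "0 \<le> t" "t < 1"
  shows "inj_on (shift_op (cesaro t) \<mu>) (lpw p w) \<longleftrightarrow> \<mu> \<notin> Lam"
proof
  assume inj: "inj_on (shift_op (cesaro t) \<mu>) (lpw p w)"
  show "\<mu> \<notin> Lam"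
  proof
    assume "\<mu> \<in> Lam"
    then obtain m where m: "\<mu> = 1 / of_nat (m + 1)" by (auto simp: Lam_def)
    have "shift_op (cesaro t) \<mu> (cesaro_eigenvector t m) = shift_op (cesaro t) \<mu> (\<lambda>n. 0)"
      unfolding m shift_cesaro_eigenvector by (simp add: shift_op_def cesaro_def)
    moreover have "(\<lambda>n. 0) \<in> lpw p w"
      using p_pos by (simp add: lpw_def)
    ultimately have "cesaro_eigenvector t m = (\<lambda>n. 0)"
      using inj cesaro_eigenvector_lpw[OF t] by (meson inj_onD)
    then have "cesaro_eigenvector t m m = 0" by simp
    then show False by (simp add: cesaro_eigenvector_apply)
  qed
next
  assume "\<mu> \<notin> Lam"
  then show "inj_on (shift_op (cesaro t) \<mu>) (lpw p w)"
    by (metis inj_onI shift_cesaro_eq_iff)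
qed

end

theorem theorem5p1:
  fixes p t :: real and w :: "nat \<Rightarrow> real"
  assumes "1 \<le> p"
    and "0 \<le> t" and "t < 1"
    and "\<And>n. 0 < w n"
    and "decseq w"
    and "w \<longlonglongrightarrow> 0"
  shows "cesaro t \<in> cont_lin_ops (lpw_top p w)
    \<and> lpw_opnorm p w (cesaro t) \<le> ennreal (inverse (1 - t))
    \<and> lpw_compact_op p w (cesaro t)
    \<and> spec (cesaro t) (lpw_top p w) = Lam \<union> {0}
    \<and> point_spec (cesaro t) (lpw_top p w) = Lam
    \<and> cont_spec (cesaro t) (lpw_top p w) = {0}
    \<and> resid_spec (cesaro t) (lpw_top p w) = {}"
proof -
  interpret decreasing_weighted_lp p w
    by unfold_locales (use assms in auto)
  note t = assms(2,3)
  let ?X = "lpw_top p w" and ?T = "shift_op (cesaro t)"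
  have zero: "?T 0 = cesaro t" by (simp add: shift_op_def fun_eq_iff)
  have zero_Lam: "(0 :: complex) \<notin> Lam" by (simp add: not_in_Lam_iff)
  have inj: "inj_on (?T \<mu>) (topspace ?X) \<longleftrightarrow> \<mu> \<notin> Lam" for \<mu>
    unfolding topspace_lpw_top by (rule shift_cesaro_inj_on_iff[OF t])
  \<comment> \<open>At 0 the operator has a proper dense range; elsewhere off \<open>Lam\<close> it is invertible.\<close>
  have range0: "?T 0 ` topspace ?X \<noteq> topspace ?X"
    and dense0: "?X closure_of (?T 0 ` topspace ?X) = topspace ?X"
    unfolding zero topspace_lpw_top using cesaro_not_surj[OF t] cesaro_range_dense[OF t] by auto
  have surj_of_inv: "?T \<mu> ` topspace ?X = topspace ?X" if inv: "invertible_op ?X (?T \<mu>)" for \<mu>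
  proof -
    obtain S where S: "S \<in> cont_lin_ops ?X" "?T \<mu> \<in> cont_lin_ops ?X"
      "\<forall>x\<in>topspace ?X. S (?T \<mu> x) = x \<and> ?T \<mu> (S x) = x"
      using inv unfolding invertible_op_def by blast
    then have "S x \<in> topspace ?X" "?T \<mu> x \<in> topspace ?X" if "x \<in> topspace ?X" for x
      using that by (auto simp: cont_lin_ops_def continuous_map_def)
    moreover have "x = ?T \<mu> (S x)" if "x \<in> topspace ?X" for x
      using S(3) that by simp
    ultimately show ?thesis by (intro equalityI subsetI) (auto intro: image_eqI)
  qed
  have surj: "?T \<mu> ` topspace ?X = topspace ?X" if "\<mu> \<notin> Lam" "\<mu> \<noteq> 0" for \<mu>
    by (rule surj_of_inv[OF shift_cesaro_invertible[OF t that]])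
  have inj_of_inv: "\<mu> \<notin> Lam" if inv: "invertible_op ?X (?T \<mu>)" for \<mu>
  proof -
    obtain S where "\<forall>x\<in>topspace ?X. S (?T \<mu> x) = x"
      using inv unfolding invertible_op_def by blast
    then have "inj_on (?T \<mu>) (topspace ?X)" by (intro inj_on_inverseI[where g = S]) simp
    then show ?thesis using inj by blast
  qed
  have "invertible_op ?X (?T \<mu>) \<longleftrightarrow> \<mu> \<notin> Lam \<and> \<mu> \<noteq> 0" for \<mu>
  proof (intro iffI conjI)
    assume inv: "invertible_op ?X (?T \<mu>)"
    show "\<mu> \<notin> Lam" by (rule inj_of_inv[OF inv])
    show "\<mu> \<noteq> 0"
    proof
      assume "\<mu> = 0"
      with surj_of_inv[OF inv] range0 show False by blast
    qed
  qed (use shift_cesaro_invertible[OF t] in simp)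
  then have spec: "spec (cesaro t) ?X = Lam \<union> {0}"
    by (auto simp: spec_def)
  have point: "point_spec (cesaro t) ?X = Lam"
    by (simp add: point_spec_def inj)
  have "?T \<mu> ` topspace ?X \<noteq> topspace ?X \<longleftrightarrow> \<mu> = 0" if "\<mu> \<notin> Lam" for \<mu>
    using that range0 surj[of \<mu>] by (cases "\<mu> = 0") (simp_all only: not_False_eq_True simp_thms)
  moreover have dense: "?X closure_of (?T \<mu> ` topspace ?X) = topspace ?X" if "\<mu> \<notin> Lam" for \<mu>
    using that dense0 surj[of \<mu>] closure_of_topspace[of ?X] by (cases "\<mu> = 0") (simp_all only: simp_thms)
  ultimately have cont: "cont_spec (cesaro t) ?X = {0}"
    using zero_Lam by (auto simp only: cont_spec_def inj mem_Collect_eq singleton_iff)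
  have resid: "resid_spec (cesaro t) ?X = {}"
    using dense by (auto simp only: resid_spec_def inj mem_Collect_eq)
  show ?thesis
    using cesaro_in_cont_lin_ops[OF t] cesaro_opnorm_le[OF t] cesaro_compact[OF t]
      spec point cont resid by (intro conjI)
qed

end
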